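(* Let $X\in\mathbb{R}^{n\times p}$ with $\mathrm{rank}(X)=p$, let $X_{new}\in\mathbb{R}^{n\times p}$ be fixed, and assume the linear model $\mu(X)=X\beta^0$, $\mu(X_{new})=X_{new}\beta^0$ for some $\beta^0\in\mathbb{R}^p$. Let $y\sim N(\mu(X),\sigma^2I_n)$, and for $\alpha>0$ let $\omega\sim N(0,\alpha\sigma^2I_n)$ be independent of $y$, $y^*=y+\omega$, $y^-=y-\frac1\alpha\omega$. Let $\hat M:\mathbb{R}^n\to 2^{\{1,\dots,p\}}$ be a measurable selection map. Put $$H_0=X_{new}(X^TX)^{-1}X^T,\qquad H_{\hat M(y^* )}=X_{new,\hat M(y^* )}\left(X_{\hat M(y^* )}^TX_{\hat M(y^* )}\right)^{-1}X_{\hat M(y^* )}^T .$$ Then $$\widehat{\mathrm{Err}}_{out,\alpha}=\left\|H_0y^--H_{\hat M(y^* )}y\right\|_2^2+2\,\mathrm{tr}\!\left(H_0^TH_{\hat M(y^* )}\right)\sigma^2+n\sigma^2-\mathrm{tr}\!\left(H_0^TH_0\right)\left(1+\frac1\alpha\right)\sigma^2$$ is unbiased for $\mathrm{Err}_{out,\alpha}$, i.e. $\mathbb{E}[\widehat{\mathrm{Err}}_{out,\alpha}]=\mathrm{Err}_{out,\alpha}$.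
   Context: $X$ and $X_{new}$ are fixed matrices, $\sigma^2>0$ is fixed and known. For $M\subseteq\{1,\dots,p\}$, $X_M$ and $X_{new,M}$ denote the submatrices of $X$ and $X_{new}$ with columns in $M$ (for $M=\emptyset$ the corresponding matrix $H_M$ is $0$). The randomized out-of-sample prediction error is $$\mathrm{Err}_{out,\alpha}=\mathbb{E}\left[\left\|\mu(X_{new})-X_{new,M}\,\bar\beta^*(y)\right\|_2^2\right]+n\sigma^2,\qquad \bar\beta^*(y)=(X_M^TX_M)^{-1}X_M^Ty,\quad M=\hat M(y^* ).$$ *)

theory Defs
  imports "HOL-Probability.Probability"
begin

text \<open>Density of the normal distribution with mean \<open>m\<close> and (positive definite) covariance
  matrix \<open>S\<close>; the library only has the univariate \<open>normal_density\<close>.\<close>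

definition mvn_density :: "real^'n \<Rightarrow> real^'n^'n \<Rightarrow> real^'n \<Rightarrow> real" where
  "mvn_density m S x =
     exp (- ((x - m) \<bullet> (matrix_inv S *v (x - m))) / 2) / sqrt ((2 * pi) ^ CARD('n) * det S)"

definition mvn_distributed :: "'a measure \<Rightarrow> ('a \<Rightarrow> real^'n) \<Rightarrow> real^'n \<Rightarrow> real^'n^'n \<Rightarrow> bool" where
  "mvn_distributed P Y m S \<longleftrightarrow> distributed P lborel Y (\<lambda>x. ennreal (mvn_density m S x))"

text \<open>
  The submatrix \<open>X\<^sub>M\<close> has \<open>|M|\<close> columns, and \<open>M\<close> is random, so its number of columns cannot be
  a type. It is encoded as a matrix over the full column index type whose columns outside
  \<open>M\<close> vanish. Likewise a square matrix indexed by \<open>M\<close> is encoded as a matrix vanishing outside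
  \<open>M \<times> M\<close>; \<open>block_one M\<close> is the identity and \<open>block_inv M\<close> the inverse of such matrices, in the
  same style as \<open>matrix_inv\<close>. The lemma \<open>hat_matrix_eq_submatrix\<close> below relates this to genuine
  submatrices.
\<close>

definition cols :: "real^'p^'n \<Rightarrow> 'p set \<Rightarrow> real^'p^'n" where
  "cols X M = (\<chi> i j. if j \<in> M then X $ i $ j else 0)"

definition block_one :: "'p set \<Rightarrow> real^'p^'p" where
  "block_one M = (\<chi> i j. if i = j \<and> i \<in> M then 1 else 0)"

definition block_inv :: "'p::finite set \<Rightarrow> real^'p^'p \<Rightarrow> real^'p^'p" where
  "block_inv M A = (SOME B. (\<forall>i j. i \<notin> M \<or> j \<notin> M \<longrightarrow> B $ i $ j = 0) \<and>
     A ** B = block_one M \<and> B ** A = block_one M)"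

definition beta_bar :: "real^'p^'n \<Rightarrow> 'p set \<Rightarrow> real^'n \<Rightarrow> real^'p" where
  "beta_bar X M y = block_inv M (transpose (cols X M) ** cols X M) *v (transpose (cols X M) *v y)"

definition hat_matrix :: "real^'p^'n \<Rightarrow> real^'p^'n \<Rightarrow> 'p set \<Rightarrow> real^'n^'n" where
  "hat_matrix X Xnew M =
     cols Xnew M ** block_inv M (transpose (cols X M) ** cols X M) ** transpose (cols X M)"

definition full_hat_matrix :: "real^'p^'n \<Rightarrow> real^'p^'n \<Rightarrow> real^'n^'n" where
  "full_hat_matrix X Xnew = Xnew ** matrix_inv (transpose X ** X) ** transpose X"

text \<open>In the following, \<open>\<mu>new\<close> is the mean vector \<open>\<mu>(X\<^sub>n\<^sub>e\<^sub>w)\<close>, \<open>y\<close> and \<open>w\<close> are random vectors on \<open>P\<close>,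
  and \<open>y + w\<close> and \<open>y - w / \<alpha>\<close> are the randomized responses \<open>y\<^sup>*\<close> and \<open>y\<^sup>-\<close>.\<close>

definition pred_loss ::
  "real^'p^'n \<Rightarrow> real^'p^'n \<Rightarrow> real^'n \<Rightarrow> (real^'n \<Rightarrow> 'p set) \<Rightarrow>
   ('a \<Rightarrow> real^'n) \<Rightarrow> ('a \<Rightarrow> real^'n) \<Rightarrow> 'a \<Rightarrow> real" where
  "pred_loss X Xnew \<mu>new Mhat y w s =
     (let M = Mhat (y s + w s)
      in (norm (\<mu>new - cols Xnew M *v beta_bar X M (y s)))\<^sup>2)"

definition err_out ::
  "'a measure \<Rightarrow> real^'p^'n \<Rightarrow> real^'p^'n \<Rightarrow> real^'n \<Rightarrow> real \<Rightarrow> (real^'n \<Rightarrow> 'p set) \<Rightarrow>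
   ('a \<Rightarrow> real^'n) \<Rightarrow> ('a \<Rightarrow> real^'n) \<Rightarrow> real" where
  "err_out P X Xnew \<mu>new \<sigma> Mhat y w =
     integral\<^sup>L P (pred_loss X Xnew \<mu>new Mhat y w) + real CARD('n) * \<sigma>\<^sup>2"

definition err_out_hat ::
  "real^'p^'n \<Rightarrow> real^'p^'n \<Rightarrow> real \<Rightarrow> real \<Rightarrow> (real^'n \<Rightarrow> 'p set) \<Rightarrow>
   ('a \<Rightarrow> real^'n) \<Rightarrow> ('a \<Rightarrow> real^'n) \<Rightarrow> 'a \<Rightarrow> real" where
  "err_out_hat X Xnew \<sigma> \<alpha> Mhat y w s =
     (let H0 = full_hat_matrix X Xnew;
          H = hat_matrix X Xnew (Mhat (y s + w s));
          yminus = y s - (1 / \<alpha>) *\<^sub>R w s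
      in (norm (H0 *v yminus - H *v y s))\<^sup>2
           + 2 * trace (transpose H0 ** H) * \<sigma>\<^sup>2
           + real CARD('n) * \<sigma>\<^sup>2
           - trace (transpose H0 ** H0) * (1 + 1 / \<alpha>) * \<sigma>\<^sup>2)"

text \<open>The Bochner integral is 0 for non-integrable functions, so integrability is part of
  unbiasedness.\<close>

definition unbiased :: "'a measure \<Rightarrow> ('a \<Rightarrow> real) \<Rightarrow> real \<Rightarrow> bool" where
  "unbiased P T \<theta> \<longleftrightarrow> integrable P T \<and> integral\<^sup>L P T = \<theta>"

lemma block_inv_eq:
  fixes A B :: "real^'p^'p"
  assumes B: "block_one M ** B = B" "B ** block_one M = B"
    and AB: "A ** B = block_one M" and BA: "B ** A = block_one M"
  shows "block_inv M A = B"
proof -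
  have entry: "(block_one M :: real^'p^'p) $ i $ j = (if i = j then of_bool (i \<in> M) else 0)" for i j
    by (simp add: block_one_def)
  have ifm: "(if b then u else 0) * z = (if b then u * z else 0)"
    "z * (if b then u else 0) = (if b then z * u else 0)" for b and u z :: real
    by simp_all
  have left: "block_one M ** D = (\<chi> i j. if i \<in> M then D $ i $ j else 0)" for D :: "real^'p^'p"
    by (simp add: vec_eq_iff matrix_matrix_mult_def entry ifm)
  have right: "D ** block_one M = (\<chi> i j. if j \<in> M then D $ i $ j else 0)" for D :: "real^'p^'p"
    by (simp add: vec_eq_iff matrix_matrix_mult_def entry ifm)
  have supp: "(\<forall>i j. i \<notin> M \<or> j \<notin> M \<longrightarrow> D $ i $ j = 0) \<longleftrightarrow>
      block_one M ** D = D \<and> D ** block_one M = D" for D :: "real^'p^'p"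
    unfolding left right by (auto simp: vec_eq_iff)
  show ?thesis
    unfolding block_inv_def supp
  proof (rule some_equality)
    fix C assume C: "(block_one M ** C = C \<and> C ** block_one M = C) \<and>
      A ** C = block_one M \<and> C ** A = block_one M"
    have "C = C ** (A ** B)" using C AB by simp
    also have "\<dots> = (C ** A) ** B" by (simp add: matrix_mul_assoc)
    finally show "C = B" using C B by simp
  qed (use assms in simp)
qed

lemma hat_matrix_eq_submatrix:
  fixes X Xnew :: "real^'p^'n" and f :: "'k::finite \<Rightarrow> 'p"
  defines "S \<equiv> \<lambda>Z :: real^'p^'n. (\<chi> i k. Z $ i $ f k) :: real^'k^'n"
  assumes f: "bij_betw f UNIV M" and inv: "invertible (transpose (S X) ** S X)"
  shows "hat_matrix X Xnew M
    = S Xnew ** matrix_inv (transpose (S X) ** S X) ** transpose (S X)"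
proof -
  define E :: "real^'p^'k" where "E = (\<chi> k j. if f k = j then 1 else 0)"
  define T where "T = transpose E"
  define G where "G = transpose (S X) ** S X"
  define I where "I = matrix_inv G"
  have GI: "G ** I = mat 1" "I ** G = mat 1"
    using someI_ex[OF inv[unfolded invertible_def]] unfolding I_def G_def matrix_inv_def by auto
  have injf: "inj f" and M: "M = range f"
    using f by (auto simp: bij_betw_def)
  have eqs: "f k = f l \<longleftrightarrow> k = l" for k l
    using injf by (auto dest: injD)
  have delta: "(\<Sum>k\<in>UNIV. if f k = j then g k else 0) = (if j \<in> M then g (inv f j) else 0)"
    for j and g :: "'k \<Rightarrow> real"
  proof (cases "j \<in> M")
    case True
    then obtain l where "j = f l" using M by auto
    then show ?thesis using True injf by (simp add: eqs)
  qed (auto simp: M intro!: sum.neutral)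
  have ifm: "(if b then 1 else 0) * z = (if b then z else 0)"
    "z * (if b then 1 else 0) = (if b then z else 0)" for b and z :: real
    by simp_all
  have ET: "E ** T = mat 1"
    by (simp add: vec_eq_iff matrix_matrix_mult_def E_def T_def transpose_def mat_def ifm(1) eqs)
  have TE: "T ** E = block_one M"
    by (simp add: vec_eq_iff matrix_matrix_mult_def E_def T_def transpose_def block_one_def ifm(1) delta)
       (auto simp: M f_inv_into_f injf)
  have cols: "cols Z M = S Z ** E" for Z
    by (simp add: vec_eq_iff matrix_matrix_mult_def E_def S_def cols_def ifm(2) delta)
       (auto simp: M f_inv_into_f injf)
  have ET': "Z ** E ** T = Z" for Z :: "real^'k^'m"
    using ET by (simp add: matrix_mul_assoc[symmetric])
  have gram: "transpose (cols X M) ** cols X M = T ** G ** E"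
    by (simp add: cols matrix_transpose_mul T_def G_def matrix_mul_assoc)
  have GI': "Z ** G ** I = Z" "Z ** I ** G = Z" for Z :: "real^'k^'m"
    using GI by (simp_all add: matrix_mul_assoc[symmetric])
  have "block_inv M (T ** G ** E) = T ** I ** E"
    by (rule block_inv_eq) (simp_all add: TE[symmetric] matrix_mul_assoc ET' GI')
  then show ?thesis
    unfolding hat_matrix_def gram
    by (simp add: cols matrix_transpose_mul T_def[symmetric] matrix_mul_assoc ET')
       (simp add: I_def G_def)
qed

lemma mvn_density_isotropic:
  fixes m x :: "real^'n"
  assumes "v > 0"
  shows "mvn_density m (mat v) x = (\<Prod>i\<in>UNIV. normal_density (m $ i) (sqrt v) (x $ i))"
proof -
  have ifm: "(if b then u else 0) * z = (if b then u * z else 0)" for b and u z :: real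
    by simp
  have mul: "mat a ** mat b = (mat (a * b) :: real^'n^'n)" for a b :: real
    by (simp add: vec_eq_iff matrix_matrix_mult_def mat_def ifm)
  have inv: "matrix_inv (mat v :: real^'n^'n) = mat (1 / v)"
    unfolding matrix_inv_def
  proof (rule some_equality)
    fix B :: "real^'n^'n" assume B: "mat v ** B = mat 1 \<and> B ** mat v = mat 1"
    have "B = B ** (mat v ** mat (1 / v))" using assms by (simp add: mul)
    also have "\<dots> = mat (1 / v)" using B by (simp add: matrix_mul_assoc)
    finally show "B = mat (1 / v)" .
  qed (use assms in \<open>simp add: mul\<close>)
  have det: "det (mat v :: real^'n^'n) = v ^ CARD('n)"
    by (subst det_diagonal) (auto simp: mat_def)
  have mv: "(mat (1 / v) :: real^'n^'n) *v z = (1 / v) *\<^sub>R z" for z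
    by (simp add: vec_eq_iff matrix_vector_mult_def mat_def ifm)
  have "sqrt ((2 * pi) ^ CARD('n) * v ^ CARD('n)) = (\<Prod>i\<in>(UNIV :: 'n set). sqrt (2 * pi * v))"
    by (simp only: power_mult_distrib[symmetric] real_sqrt_power prod_constant)
  moreover have "- ((x - m) \<bullet> ((1 / v) *\<^sub>R (x - m))) / 2 = (\<Sum>i\<in>UNIV. - (x $ i - m $ i)\<^sup>2 / (2 * v))"
    by (simp only: inner_scaleR_right inner_vec_def sum_distrib_left sum_negf[symmetric] sum_divide_distrib)
       (rule sum.cong, simp_all add: power2_eq_square)
  ultimately show ?thesis
    using assms unfolding mvn_density_def inv det mv normal_density_def
    by (simp only: prod.distrib prod_dividef exp_sum finite real_sqrt_pow2 less_imp_le) simp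
qed

end

theory Submission imports Defs begin

text \<open>
  The vectors \<open>u = y + w\<close> and \<open>v = y - w / \<alpha>\<close> are uncorrelated Gaussians, hence independent, and
  \<open>y = (u + \<alpha> v) / (1 + \<alpha>)\<close>. On the event that \<open>Mhat u = M\<close> the matrix \<open>H\<^sub>M\<close> is constant. Since
  the mean of \<open>y\<close> lies in the column space of \<open>X\<close>, \<open>\<mu>(X\<^sub>n\<^sub>e\<^sub>w) = H\<^sub>0 \<mu>(X)\<close>; expanding
  \<open>H\<^sub>0 v - H\<^sub>M y\<close> around \<open>H\<^sub>0 \<mu>(X) - H\<^sub>M y\<close> leaves linear and quadratic forms in the centred \<open>v\<close>
  with coefficients that depend on \<open>u\<close> only. The linear forms have mean zero, and the quadratic
  ones are compensated exactly by the two trace terms.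
\<close>

section \<open>Moments of isotropic Gaussian vectors\<close>

text \<open>Lebesgue measure on a Euclidean space is the image of a product measure indexed by
  \<open>Basis\<close>, and for \<open>real^'n\<close> the basis vectors are exactly
  \<open>axis i 1\<close>. Reindexing along this bijection turns the product rule for
  \<open>Basis\<close> into one for coordinates.\<close>

lemma has_bochner_integral_lborel_prod:
  fixes f :: "'n::finite \<Rightarrow> real \<Rightarrow> real"
  assumes f: "\<And>i. has_bochner_integral lborel (f i) (c i)"
  shows "has_bochner_integral lborel (\<lambda>x :: real^'n. \<Prod>i\<in>UNIV. f i (x $ i)) (\<Prod>i\<in>UNIV. c i)"
proof -
  interpret L: product_sigma_finite "\<lambda>_ :: real^'n. lborel :: real measure" ..
  define g :: "real^'n \<Rightarrow> real \<Rightarrow> real" where "g b = f (axis_index b)" for b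
  have bij: "bij_betw (\<lambda>i :: 'n. axis i (1::real)) UNIV Basis"
    by (auto simp: bij_betw_def inj_on_def axis_eq_axis Basis_vec_def)
  have ax: "axis_index (axis i (1::real)) = i" for i :: 'n
    using axis_index_axis by simp
  have reindex: "(\<Prod>b\<in>Basis. h (axis_index b) b) = (\<Prod>i\<in>UNIV. h i (axis i 1))"
    for h :: "'n \<Rightarrow> real^'n \<Rightarrow> real"
    by (simp add: prod.reindex_bij_betw[OF bij, symmetric] ax)
  have g: "integrable lborel (g b)" "integral\<^sup>L lborel (g b) = c (axis_index b)" for b
    using f by (auto simp: g_def has_bochner_integral_iff)
  have meas[measurable]: "f i \<in> borel_measurable borel" for i
    using f[of i] by (auto simp: has_bochner_integral_iff)
  have eq: "(\<Prod>i\<in>UNIV. f i ((\<Sum>b\<in>Basis. h b *\<^sub>R b) $ i)) = (\<Prod>b\<in>Basis. g b (h b))" for h :: "real^'n \<Rightarrow> real"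
  proof -
    have "(\<Sum>b\<in>Basis. h b *\<^sub>R b) $ i = h (axis i 1)" for i
    proof -
      have "(\<Sum>b\<in>Basis. h b *\<^sub>R b) $ i = (\<Sum>b\<in>Basis. h b *\<^sub>R b) \<bullet> axis i 1"
        by (simp add: inner_axis)
      also have "\<dots> = h (axis i 1)"
        by (subst inner_sum_left_Basis) (auto simp: axis_in_Basis_iff)
      finally show ?thesis .
    qed
    then show ?thesis
      using reindex[of "\<lambda>i b. f i (h b)"] by (simp add: g_def)
  qed
  have "has_bochner_integral (\<Pi>\<^sub>M b\<in>(Basis :: (real^'n) set). lborel) (\<lambda>h. \<Prod>b\<in>Basis. g b (h b)) (\<Prod>b\<in>(Basis :: (real^'n) set). c (axis_index b))"
    using g by (simp add: has_bochner_integral_iff L.product_integrable_prod L.product_integral_prod)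
  also have "(\<Prod>b\<in>(Basis :: (real^'n) set). c (axis_index b)) = (\<Prod>i\<in>UNIV. c i)"
    by (rule reindex)
  finally show ?thesis
    by (subst lborel_eq) (simp add: has_bochner_integral_iff integrable_distr_eq integral_distr eq del: sum_component)
qed

lemma borel_measurable_mvn_density_isotropic [measurable]:
  "v > 0 \<Longrightarrow> mvn_density m (mat v) \<in> borel_measurable borel"
  by (simp add: mvn_density_isotropic cong: measurable_cong)

lemma mvn_density_isotropic_nonneg: "v > 0 \<Longrightarrow> 0 \<le> mvn_density m (mat v) x"
  by (simp add: mvn_density_isotropic prod_nonneg)

text \<open>The isotropic density is a product over coordinates, so the expectation splits into
  one-dimensional integrals. The choice of the factors \<open>g i\<close> then yields first and
  second moments alike.\<close>

lemma mvn_isotropic_moment_prod: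
  fixes Y :: "'a \<Rightarrow> real^'n" and g :: "'n \<Rightarrow> real \<Rightarrow> real"
  assumes Y: "mvn_distributed P Y m (mat v)" and v: "v > 0"
    and [measurable]: "\<And>i. g i \<in> borel_measurable borel"
    and g: "\<And>i. has_bochner_integral lborel (\<lambda>t. normal_density (m $ i) (sqrt v) t * g i t) (c i)"
  shows "has_bochner_integral P (\<lambda>s. \<Prod>i\<in>UNIV. g i (Y s $ i)) (\<Prod>i\<in>UNIV. c i)"
proof -
  have D: "distributed P lborel Y (\<lambda>x. ennreal (mvn_density m (mat v) x))"
    using Y by (simp add: mvn_distributed_def)
  have "has_bochner_integral lborel
      (\<lambda>x. mvn_density m (mat v) x * (\<Prod>i\<in>UNIV. g i (x $ i))) (\<Prod>i\<in>UNIV. c i)"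
    using has_bochner_integral_lborel_prod[OF g] v
    by (simp add: mvn_density_isotropic prod.distrib)
  then show ?thesis
    using distributed_integrable[OF D, of "\<lambda>x. \<Prod>i\<in>UNIV. g i (x $ i)"]
      distributed_integral[OF D, of "\<lambda>x. \<Prod>i\<in>UNIV. g i (x $ i)"] v
    by (simp add: has_bochner_integral_iff mvn_density_isotropic_nonneg)
qed

lemma prod_if_two:
  fixes a :: "'n::finite \<Rightarrow> 'b::comm_monoid_mult"
  shows "(\<Prod>k\<in>UNIV. (if k = i then a k else 1) * (if k = j then b k else 1)) = a i * b j"
  by (simp add: prod.distrib prod.delta)

lemma mvn_isotropic_mean:
  fixes Y :: "'a \<Rightarrow> real^'n"
  assumes "mvn_distributed P Y m (mat v)" and v: "v > 0"
  shows "has_bochner_integral P (\<lambda>s. (Y s - m) $ i) 0"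
proof -
  have "has_bochner_integral lborel
      (\<lambda>t. normal_density (m $ k) (sqrt v) t * (if k = i then t - m $ k else 1)) (if k = i then 0 else 1)" for k
    using normal_moment_odd[of "sqrt v" "m $ k" 0] normal_moment_even[of "sqrt v" "m $ k" 0] v
    by (cases "k = i") auto
  from mvn_isotropic_moment_prod[OF assms _ this]
  show ?thesis by (simp add: prod.delta if_distrib)
qed

lemma mvn_isotropic_covariance:
  fixes Y :: "'a \<Rightarrow> real^'n"
  assumes "mvn_distributed P Y m (mat v)" and v: "v > 0"
  shows "has_bochner_integral P (\<lambda>s. (Y s - m) $ i * (Y s - m) $ j) (if i = j then v else 0)"
proof -
  \<comment> \<open>The factor is constantly 1 away from \<open>i\<close> and \<open>j\<close>. For
    \<open>i = j\<close> the remaining factor is a square and contributes the variance; for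
    \<open>i \<noteq> j\<close> the factor at \<open>i\<close> is a first central moment, and its
    value 0 annihilates the product.\<close>
  have "has_bochner_integral lborel
      (\<lambda>t. normal_density (m $ k) (sqrt v) t * ((if k = i then t - m $ k else 1) * (if k = j then t - m $ k else 1)))
      (if k = i then (if i = j then v else 0) else if k = j then 0 else 1)" for k
    using normal_moment_odd[of "sqrt v" "m $ k" 0] normal_moment_even[of "sqrt v" "m $ k" 0]
      normal_moment_even[of "sqrt v" "m $ k" 1] v by (auto simp: power2_eq_square fact_numeral)
  from mvn_isotropic_moment_prod[OF assms _ this]
  show ?thesis
    by (cases "i = j") (simp_all add: prod_if_two prod.delta prod.remove[of _ i])
qed

section \<open>Independence of the two randomized responses\<close>

lemma nn_integral_mvn_density_isotropic:
  assumes "v > 0"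
  shows "(\<integral>\<^sup>+x. ennreal (mvn_density m (mat v) (x :: real^'n)) \<partial>lborel) = 1"
proof -
  have "has_bochner_integral lborel (normal_density (m $ i) (sqrt v)) 1" for i
    using assms by (simp add: has_bochner_integral_iff)
  from has_bochner_integral_lborel_prod[OF this]
  have "has_bochner_integral lborel (mvn_density m (mat v)) 1"
    using assms by (simp add: mvn_density_isotropic cong: has_bochner_integral_cong)
  then show ?thesis
    using assms by (simp add: has_bochner_integral_iff nn_integral_eq_integral mvn_density_isotropic_nonneg)
qed

lemma nn_integral_lborel_affine:
  fixes t :: "'a::euclidean_space"
  assumes [measurable]: "f \<in> borel_measurable borel" and c: "c \<noteq> 0"
  shows "(\<integral>\<^sup>+x. f x \<partial>lborel) = ennreal (\<bar>c\<bar> ^ DIM('a)) * (\<integral>\<^sup>+x. f (t + c *\<^sub>R x) \<partial>lborel)"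
  by (subst lborel_affine[OF c, of t])
     (simp add: nn_integral_density nn_integral_distr nn_integral_cmult)

text \<open>With \<open>s = y + w\<close> and \<open>t = y - w / a\<close>, solving gives
  \<open>w = k * (s - t)\<close> and \<open>y = s - k * (s - t)\<close>, and \<open>k\<close> is the
  absolute Jacobian of this substitution. The joint density factors because the covariance of
  \<open>s\<close> and \<open>t\<close> is \<open>v - (1 / a) * (a * v) = 0\<close>.\<close>

lemma normal_density_decorrelate:
  fixes a v m s t :: real
  assumes a: "a > 0" and v: "v > 0"
  defines "k \<equiv> a / (1 + a)"
  shows "k * (normal_density m (sqrt v) (s - k * (s - t)) * normal_density 0 (sqrt (a * v)) (k * (s - t)))
    = normal_density m (sqrt ((1 + a) * v)) s * normal_density m (sqrt ((1 + 1 / a) * v)) t"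
proof -
  have expo: "(s - k * (s - t) - m)\<^sup>2 / (2 * v) + (k * (s - t))\<^sup>2 / (2 * (a * v))
      = (s - m)\<^sup>2 / (2 * ((1 + a) * v)) + (t - m)\<^sup>2 / (2 * ((1 + 1 / a) * v))"
  proof -
    define S where "S = s - m"
    define T where "T = t - m"
    have "s - k * (s - t) - m = (S + a * T) / (1 + a)" "k * (s - t) = a * (S - T) / (1 + a)"
      using a by (simp_all add: k_def S_def T_def field_simps)
    moreover have "((S + a * T) / (1 + a))\<^sup>2 / (2 * v) + (a * (S - T) / (1 + a))\<^sup>2 / (2 * (a * v))
      = ((S + a * T)\<^sup>2 + a * (S - T)\<^sup>2) / (2 * v * (1 + a)\<^sup>2)"
      using a v by (simp add: divide_simps power2_eq_square)
    moreover have "S\<^sup>2 / (2 * ((1 + a) * v)) + T\<^sup>2 / (2 * ((1 + 1 / a) * v))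
      = (1 + a) * (S\<^sup>2 + a * T\<^sup>2) / (2 * v * (1 + a)\<^sup>2)"
      using a v by (simp add: divide_simps power2_eq_square add_pos_pos) (simp add: algebra_simps)
    \<comment> \<open>The mixed terms \<open>2 * a * S * T\<close> cancel; this is the vanishing
      covariance in the exponent.\<close>
    moreover have "(S + a * T)\<^sup>2 + a * (S - T)\<^sup>2 = (1 + a) * (S\<^sup>2 + a * T\<^sup>2)"
      by (simp add: power2_eq_square algebra_simps)
    ultimately show ?thesis
      by (simp add: S_def T_def)
  qed
  \<comment> \<open>The variances multiply to \<open>a * v^2\<close> on the left and to
    \<open>(1 + a)^2 * v^2 / a\<close> on the right; the square root of their ratio is
    \<open>(1 + a) / a\<close>, which the factor \<open>k\<close> offsets.\<close>
  have const: "k / (sqrt (2 * pi * v) * sqrt (2 * pi * (a * v)))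
      = 1 / (sqrt (2 * pi * ((1 + a) * v)) * sqrt (2 * pi * ((1 + 1 / a) * v)))"
  proof -
    have "2 * pi * v * (2 * pi * (a * v)) = (2 * pi * v)\<^sup>2 * a"
      by (simp add: power2_eq_square)
    then have 1: "sqrt (2 * pi * v) * sqrt (2 * pi * (a * v)) = 2 * pi * v * sqrt a"
      using v by (simp only: real_sqrt_mult[symmetric]) (simp add: real_sqrt_mult)
    have "2 * pi * ((1 + a) * v) * (2 * pi * ((1 + 1 / a) * v)) = (2 * pi * v * (1 + a))\<^sup>2 / a"
      using a by (simp add: power2_eq_square field_simps)
    then have 2: "sqrt (2 * pi * ((1 + a) * v)) * sqrt (2 * pi * ((1 + 1 / a) * v))
        = 2 * pi * v * (1 + a) / sqrt a"
      using v a by (simp only: real_sqrt_mult[symmetric]) (simp add: real_sqrt_divide real_sqrt_mult)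
    have "sqrt a * sqrt a = a" using a by simp
    then show ?thesis
      unfolding 1 2 k_def using a v by (simp add: divide_simps)
  qed
  have nd: "normal_density \<mu> (sqrt r) x * normal_density \<mu>' (sqrt r') x'
      = 1 / (sqrt (2 * pi * r) * sqrt (2 * pi * r')) * exp (- ((x - \<mu>)\<^sup>2 / (2 * r) + (x' - \<mu>')\<^sup>2 / (2 * r')))"
    if "r > 0" "r' > 0" for \<mu> r x \<mu>' r' x'
    using that by (simp add: normal_density_def exp_add[symmetric])
  have pos: "0 < (1 + a) * v" "0 < (1 + 1 / a) * v" "0 < a * v"
    using a v by (simp_all add: add_pos_pos)
  show ?thesis
    unfolding nd[OF v pos(3)] nd[OF pos(1,2)] diff_zero expo const[symmetric] by simp
qed

lemma mvn_density_decorrelate: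
  fixes m s t :: "real^'n"
  assumes a: "a > 0" and v: "v > 0"
  defines "k \<equiv> a / (1 + a)"
  shows "k ^ CARD('n) * (mvn_density m (mat v) (s - k *\<^sub>R (s - t)) * mvn_density 0 (mat (a * v)) (k *\<^sub>R (s - t)))
    = mvn_density m (mat ((1 + a) * v)) s * mvn_density m (mat ((1 + 1 / a) * v)) t"
proof -
  have pos: "0 < (1 + a) * v" "0 < (1 + 1 / a) * v" "0 < a * v"
    using a v by (simp_all add: add_pos_pos)
  show ?thesis
    using normal_density_decorrelate[OF a v, folded k_def] v pos
    by (simp add: mvn_density_isotropic prod.distrib[symmetric] flip: prod_constant)
qed

text \<open>It suffices to compute the probability of each rectangle. Changing variables in the
  joint density of \<open>y\<close> and \<open>w\<close> makes it a product of two integrals;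
  whole-space sides give the marginals, and general rectangles give the product law.\<close>

lemma (in prob_space) mvn_isotropic_decorrelate:
  fixes y w :: "'a \<Rightarrow> real^'n"
  assumes a: "a > 0" and v: "v > 0"
    and y: "mvn_distributed M y m (mat v)" and w: "mvn_distributed M w 0 (mat (a * v))"
    and ind: "indep_var borel y borel w"
  shows "indep_var borel (\<lambda>s. y s + w s) borel (\<lambda>s. y s - (1 / a) *\<^sub>R w s)"
    and "mvn_distributed M (\<lambda>s. y s - (1 / a) *\<^sub>R w s) m (mat ((1 + 1 / a) * v))"
proof -
  define k where "k = a / (1 + a)"
  have k: "k > 0" using a by (simp add: k_def)
  have pos: "0 < (1 + a) * v" "0 < (1 + 1 / a) * v" "0 < a * v"
    using a v by (simp_all add: add_pos_pos)
  note [measurable] = borel_measurable_mvn_density_isotropic[OF v] 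
    borel_measurable_mvn_density_isotropic[OF pos(1)]
    borel_measurable_mvn_density_isotropic[OF pos(2)]
    borel_measurable_mvn_density_isotropic[OF pos(3)]
  define f where "f = mvn_density m (mat v)"
  define g where "g = mvn_density (0::real^'n) (mat (a * v))"
  define f' where "f' = mvn_density m (mat ((1 + a) * v))"
  define g' where "g' = mvn_density m (mat ((1 + 1 / a) * v))"
  have [measurable]: "f \<in> borel_measurable borel" "g \<in> borel_measurable borel"
    "f' \<in> borel_measurable borel" "g' \<in> borel_measurable borel"
    unfolding f_def g_def f'_def g'_def by measurable
  have nn: "0 \<le> f x" "0 \<le> g x" "0 \<le> f' x" "0 \<le> g' x" for x
    using v pos by (simp_all add: f_def g_def f'_def g'_def mvn_density_isotropic_nonneg)
  have fg: "ennreal (k ^ CARD('n)) * (ennreal (f (s - k *\<^sub>R (s - t))) * ennreal (g (k *\<^sub>R (s - t))))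
      = ennreal (f' s) * ennreal (g' t)" for s t
    using mvn_density_decorrelate[OF a v, of m s t] nn k
    by (simp add: f_def g_def f'_def g'_def k_def ennreal_mult'[symmetric])
  have y': "distributed M lborel y f" and w': "distributed M lborel w g"
    using y w by (simp_all add: mvn_distributed_def f_def g_def)
  have [measurable]: "y \<in> borel_measurable M" "w \<in> borel_measurable M"
    using ind by (blast dest: indep_var_rv1 indep_var_rv2)+
  have "indep_var lborel y lborel w"
    using indep_var_compose[OF ind, of id lborel id lborel] by simp
  from distributed_joint_indep[OF sigma_finite_lborel sigma_finite_lborel y' w' this]
  have J: "distributed M (lborel \<Otimes>\<^sub>M lborel) (\<lambda>s. (y s, w s)) (\<lambda>(x, z). ennreal (f x) * ennreal (g z))" .
  let ?U = "\<lambda>s. y s + w s" and ?V = "\<lambda>s. y s - (1 / a) *\<^sub>R w s"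
  have rect: "(\<integral>\<^sup>+s. indicator A (?U s) * indicator B (?V s) \<partial>M)
      = (\<integral>\<^sup>+s. indicator A s * ennreal (f' s) \<partial>lborel) * (\<integral>\<^sup>+t. indicator B t * ennreal (g' t) \<partial>lborel)"
    if [measurable]: "A \<in> sets borel" "B \<in> sets borel" for A B
  proof -
    define F where "F x z = ennreal (f x) * ennreal (g z) * (indicator A (x + z) * indicator B (x - (1 / a) *\<^sub>R z))" for x z
    have [measurable]: "(\<lambda>(x, z). F x z) \<in> borel_measurable (borel \<Otimes>\<^sub>M borel)"
      unfolding F_def by measurable
    have Fm[measurable]: "(\<lambda>x. F (p x) (q x)) \<in> borel_measurable N" if [measurable]: "p \<in> borel_measurable N" "q \<in> borel_measurable N" for p q and N :: "'z measure"
      unfolding F_def by measurable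
    \<comment> \<open>The substituted values of \<open>y\<close> and \<open>w\<close> reproduce
      \<open>s\<close> as their sum and \<open>t\<close> as the randomized difference, so each
      indicator depends on one variable only.\<close>
    have lin: "s - k *\<^sub>R (s - t) + k *\<^sub>R (s - t) = s"
      "s - k *\<^sub>R (s - t) - (1 / a) *\<^sub>R (k *\<^sub>R (s - t)) = t" for s t :: "real^'n"
    proof -
      have "k + (1 / a) * k = 1" using a by (simp add: k_def field_simps)
      then have "k *\<^sub>R (s - t) + (1 / a) *\<^sub>R (k *\<^sub>R (s - t)) = s - t"
        by (metis scaleR_left_distrib scaleR_one scaleR_scaleR)
      then show "s - k *\<^sub>R (s - t) - (1 / a) *\<^sub>R (k *\<^sub>R (s - t)) = t"
        by (simp add: algebra_simps)
    qed simp
    have "(\<integral>\<^sup>+s. indicator A (?U s) * indicator B (?V s) \<partial>M)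
       = (\<integral>\<^sup>+xz. (case xz of (x, z) \<Rightarrow> F x z) \<partial>(lborel \<Otimes>\<^sub>M lborel))"
      using distributed_nn_integral[OF J, of "\<lambda>(x, z). indicator A (x + z) * indicator B (x - (1 / a) *\<^sub>R z)"]
      by (simp add: F_def case_prod_unfold)
    also have "\<dots> = (\<integral>\<^sup>+z. \<integral>\<^sup>+x. F x z \<partial>lborel \<partial>lborel)"
      by (subst lborel_pair.nn_integral_snd[symmetric]) simp_all
    \<comment> \<open>The change of variables is done in two one-vector substitutions. First, for
      fixed \<open>z\<close>, the translation \<open>x = s - z\<close> introduces
      \<open>s\<close>.\<close>
    also have "\<dots> = (\<integral>\<^sup>+z. \<integral>\<^sup>+s. F (s - z) z \<partial>lborel \<partial>lborel)"
    proof (rule nn_integral_cong)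
      fix z :: "real^'n"
      show "(\<integral>\<^sup>+x. F x z \<partial>lborel) = (\<integral>\<^sup>+s. F (s - z) z \<partial>lborel)"
        by (subst nn_integral_lborel_affine[where c = 1 and t = "- z"]) simp_all
    qed
    also have "\<dots> = (\<integral>\<^sup>+s. \<integral>\<^sup>+z. F (s - z) z \<partial>lborel \<partial>lborel)"
      by (rule lborel_pair.Fubini') (simp add: case_prod_unfold)
    \<comment> \<open>Second, with \<open>s\<close> now the outer variable,
      \<open>z = k *\<^sub>R (s - t)\<close> introduces \<open>t\<close>. Its scale
      \<open>- k\<close> has modulus \<open>k\<close>, hence the factor
      \<open>k ^ CARD('n)\<close>.\<close>
    also have "\<dots> = (\<integral>\<^sup>+s. ennreal (k ^ CARD('n)) * (\<integral>\<^sup>+t. F (s - k *\<^sub>R (s - t)) (k *\<^sub>R (s - t)) \<partial>lborel) \<partial>lborel)"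
    proof (rule nn_integral_cong)
      fix s :: "real^'n"
      show "(\<integral>\<^sup>+z. F (s - z) z \<partial>lborel) = ennreal (k ^ CARD('n)) * (\<integral>\<^sup>+t. F (s - k *\<^sub>R (s - t)) (k *\<^sub>R (s - t)) \<partial>lborel)"
        using k by (subst nn_integral_lborel_affine[where c = "- k" and t = "k *\<^sub>R s"])
          (simp_all add: scaleR_diff_right)
    qed
    also have "\<dots> = (\<integral>\<^sup>+s. (indicator A s * ennreal (f' s)) * (\<integral>\<^sup>+t. indicator B t * ennreal (g' t) \<partial>lborel) \<partial>lborel)"
    proof (rule nn_integral_cong)
      fix s :: "real^'n"
      have "ennreal (k ^ CARD('n)) * F (s - k *\<^sub>R (s - t)) (k *\<^sub>R (s - t))
          = (indicator A s * ennreal (f' s)) * (indicator B t * ennreal (g' t))" for t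
        unfolding F_def lin mult.assoc[symmetric] fg[unfolded mult.assoc[symmetric]]
        by (simp add: ac_simps)
      then show "ennreal (k ^ CARD('n)) * (\<integral>\<^sup>+t. F (s - k *\<^sub>R (s - t)) (k *\<^sub>R (s - t)) \<partial>lborel)
          = (indicator A s * ennreal (f' s)) * (\<integral>\<^sup>+t. indicator B t * ennreal (g' t) \<partial>lborel)"
        by (simp add: nn_integral_cmult[symmetric])
    qed
    also have "\<dots> = (\<integral>\<^sup>+s. indicator A s * ennreal (f' s) \<partial>lborel) * (\<integral>\<^sup>+t. indicator B t * ennreal (g' t) \<partial>lborel)"
      by (simp add: nn_integral_multc)
    finally show ?thesis .
  qed
  have one: "(\<integral>\<^sup>+s. ennreal (f' s) \<partial>lborel) = 1" "(\<integral>\<^sup>+s. ennreal (g' s) \<partial>lborel) = 1"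
    using pos by (simp_all add: f'_def g'_def nn_integral_mvn_density_isotropic)
  \<comment> \<open>Taking one side of the rectangle to be \<open>UNIV\<close> leaves a density of
    total mass 1 as the other factor.\<close>
  have mV: "emeasure (distr M lborel ?V) B = (\<integral>\<^sup>+t. indicator B t * ennreal (g' t) \<partial>lborel)"
    and mU: "emeasure (distr M lborel ?U) B = (\<integral>\<^sup>+t. indicator B t * ennreal (f' t) \<partial>lborel)"
    if [measurable]: "B \<in> sets borel" for B
    using rect[of UNIV B] rect[of B UNIV]
    by (simp_all add: one nn_integral_distr flip: nn_integral_indicator)
  show "mvn_distributed M ?V m (mat ((1 + 1 / a) * v))"
    unfolding mvn_distributed_def g'_def[symmetric] distributed_def
    by (auto intro!: measure_eqI simp: mV emeasure_density mult.commute)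
  show "indep_var borel ?U borel ?V"
    unfolding indep_var_distribution_eq
  proof (intro conjI)
    interpret U: prob_space "distr M borel ?U" by (rule prob_space_distr) simp
    interpret V: prob_space "distr M borel ?V" by (rule prob_space_distr) simp
    show "distr M borel ?U \<Otimes>\<^sub>M distr M borel ?V = distr M (borel \<Otimes>\<^sub>M borel) (\<lambda>s. (?U s, ?V s))"
    proof (rule pair_measure_eqI)
      fix A B assume "A \<in> sets (distr M borel ?U)" "B \<in> sets (distr M borel ?V)"
      then have [measurable]: "A \<in> sets borel" "B \<in> sets borel" by simp_all
      have "emeasure (distr M borel ?U) A = emeasure (distr M lborel ?U) A"
        "emeasure (distr M borel ?V) B = emeasure (distr M lborel ?V) B"
        by (simp_all add: emeasure_distr)
      moreover have "emeasure (distr M (borel \<Otimes>\<^sub>M borel) (\<lambda>s. (?U s, ?V s))) (A \<times> B)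
          = (\<integral>\<^sup>+s. indicator A (?U s) * indicator B (?V s) \<partial>M)"
        by (simp add: nn_integral_distr indicator_times flip: nn_integral_indicator)
      ultimately show "emeasure (distr M borel ?U) A * emeasure (distr M borel ?V) B
          = emeasure (distr M (borel \<Otimes>\<^sub>M borel) (\<lambda>s. (?U s, ?V s))) (A \<times> B)"
        by (simp add: mU mV rect)
    qed (auto intro: U.sigma_finite_measure_axioms V.sigma_finite_measure_axioms)
  qed simp_all
qed

section \<open>Means of linear and quadratic forms\<close>

lemma inner_matrix_vector_eq_sum:
  "z \<bullet> (B *v x) = (\<Sum>i\<in>UNIV. \<Sum>j\<in>UNIV. B $ i $ j * (z $ i * x $ j))" for z :: "real^'n"
  by (simp add: inner_vec_def matrix_vector_mult_def sum_distrib_left mult_ac)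

lemma mvn_isotropic_linear_form:
  fixes Y :: "'a \<Rightarrow> real^'n"
  assumes "mvn_distributed P Y m (mat v)" and "v > 0"
  shows "has_bochner_integral P (\<lambda>s. c \<bullet> (Y s - m)) 0"
proof -
  have "has_bochner_integral P (\<lambda>s. \<Sum>i\<in>UNIV. c $ i * (Y s - m) $ i) (\<Sum>i\<in>UNIV. c $ i * 0)"
    by (intro has_bochner_integral_sum has_bochner_integral_mult_right mvn_isotropic_mean[OF assms])
  then show ?thesis by (simp add: inner_vec_def)
qed

text \<open>Distinct coordinates are uncorrelated, so only the diagonal of \<open>B\<close>
  survives. This is the source of the traces in the estimator.\<close>

lemma mvn_isotropic_quadratic_form:
  fixes Y :: "'a \<Rightarrow> real^'n"
  assumes "mvn_distributed P Y m (mat v)" and "v > 0"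
  shows "has_bochner_integral P (\<lambda>s. (Y s - m) \<bullet> (B *v (Y s - m))) (trace B * v)"
proof -
  have "has_bochner_integral P (\<lambda>s. \<Sum>i\<in>UNIV. \<Sum>j\<in>UNIV. B $ i $ j * ((Y s - m) $ i * (Y s - m) $ j))
      (\<Sum>i\<in>UNIV. \<Sum>j\<in>UNIV. B $ i $ j * (if i = j then v else 0))"
    by (intro has_bochner_integral_sum has_bochner_integral_mult_right mvn_isotropic_covariance[OF assms])
  also have "(\<Sum>i\<in>UNIV. \<Sum>j\<in>UNIV. B $ i $ j * (if i = j then v else 0)) = trace B * v"
    by (simp add: trace_def sum_distrib_right if_distrib cong: if_cong)
  finally show ?thesis by (simp only: inner_matrix_vector_eq_sum)
qed

text \<open>Every term of the correction is a sum of such products, with \<open>U\<close> and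
  \<open>V\<close> the two randomized responses. Independence supplies integrability of the product
  together with the factorization of its mean.\<close>

lemma (in prob_space) indep_var_mult_mean_zero:
  fixes f g :: "'b \<Rightarrow> real"
  assumes ind: "indep_var S U T V" and [measurable]: "f \<in> borel_measurable S" "g \<in> borel_measurable T"
    and f: "integrable M (\<lambda>s. f (U s))" and g: "has_bochner_integral M (\<lambda>s. g (V s)) 0"
  shows "has_bochner_integral M (\<lambda>s. f (U s) * g (V s)) 0"
proof -
  have "indep_var borel (\<lambda>s. f (U s)) borel (\<lambda>s. g (V s))"
    using indep_var_compose[OF ind, of f borel g borel] by (simp add: comp_def)
  from indep_var_integrable[OF this f] indep_var_lebesgue_integral[OF this f] g
  show ?thesis by (simp add: has_bochner_integral_iff)
qed

section \<open>Linear algebra of the hat matrices and of the loss\<close>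

text \<open>A kernel vector \<open>x\<close> of the Gram matrix satisfies
  \<open>(X *v x) \<bullet> (X *v x) = 0\<close>, and full column rank makes \<open>X\<close>
  injective. So the Gram matrix is invertible and the choice in \<open>matrix_inv\<close> is a
  genuine inverse.\<close>

lemma matrix_inv_gram_cancel:
  fixes X :: "real^'p^'n"
  assumes "rank X = CARD('p)"
  shows "matrix_inv (transpose X ** X) ** (transpose X ** X) = mat 1"
proof -
  have inj: "inj ((*v) X)" using assms full_rank_injective by blast
  have "x = 0" if "(transpose X ** X) *v x = 0" for x
  proof -
    have "(X *v x) \<bullet> (X *v x) = x \<bullet> ((transpose X ** X) *v x)"
      by (metis dot_lmul_matrix inner_commute matrix_vector_mul_assoc vector_transpose_matrix)
    then have "X *v x = X *v 0" using that by simp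
    then show ?thesis using inj by (meson injD)
  qed
  then have "invertible (transpose X ** X)"
    using matrix_left_invertible_ker invertible_left_inverse by blast
  then show ?thesis
    unfolding invertible_def matrix_inv_def by (metis (mono_tags, lifting) someI_ex)
qed

text \<open>Cancelling the Gram matrix gives \<open>full_hat_matrix X Xnew ** X = Xnew\<close>. In
  the linear model this lets the full hat matrix carry the mean at \<open>X\<close> to the mean at
  \<open>Xnew\<close>.\<close>

lemma full_hat_matrix_fitted:
  assumes "rank X = CARD('p)"
  shows "full_hat_matrix X Xnew *v (X *v b) = Xnew *v (b :: real^'p)"
proof -
  have "full_hat_matrix X Xnew ** X = Xnew"
    using matrix_inv_gram_cancel[OF assms]
    by (simp add: full_hat_matrix_def flip: matrix_mul_assoc)
  then show ?thesis by (simp add: matrix_vector_mul_assoc)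
qed

lemma cols_beta_bar: "cols Xnew M *v beta_bar X M y = hat_matrix X Xnew M *v y"
  by (simp only: beta_bar_def hat_matrix_def matrix_vector_mul_assoc matrix_mul_assoc)

text \<open>The first residual is the second plus \<open>A *v z\<close>, so the difference of
  squares is \<open>(A *v z) \<bullet> (A *v z)\<close> plus twice a cross term. Writing
  \<open>y\<close> through \<open>u\<close> and \<open>z\<close> splits the cross term into a
  quadratic form in \<open>z\<close> and a linear form in \<open>z\<close> whose coefficient depends
  on \<open>u\<close> alone.\<close>

lemma loss_difference:
  fixes A H :: "real^'m^'n" and m y w :: "real^'m"
  assumes a: "a > 0"
  defines "u \<equiv> y + w" and "z \<equiv> y - (1 / a) *\<^sub>R w - m" and "k \<equiv> a / (1 + a)"
  shows "(norm (A *v (y - (1 / a) *\<^sub>R w) - H *v y))\<^sup>2 - (norm (A *v m - H *v y))\<^sup>2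
    = z \<bullet> ((transpose A ** A) *v z) - 2 * k * (z \<bullet> ((transpose A ** H) *v z))
      + 2 * ((transpose A *v (A *v m - k *\<^sub>R (H *v m)) - (1 / (1 + a)) *\<^sub>R ((transpose A ** H) *v u)) \<bullet> z)"
proof -
  have ip: "(A *v z) \<bullet> (B *v x) = z \<bullet> ((transpose A ** B) *v x)" for B :: "real^'l^'n" and x
    by (metis dot_lmul_matrix matrix_vector_mul_assoc transpose_transpose vector_transpose_matrix)
  have "(1 + a) *\<^sub>R y = u + a *\<^sub>R m + a *\<^sub>R z"
    using a by (simp add: u_def z_def algebra_simps)
  then have "(1 / (1 + a)) *\<^sub>R (1 + a) *\<^sub>R y = (1 / (1 + a)) *\<^sub>R (u + a *\<^sub>R m + a *\<^sub>R z)"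
    by simp
  \<comment> \<open>In \<open>u + a *\<^sub>R (m + z)\<close> the noise \<open>w\<close> cancels,
    which leaves \<open>(1 + a) *\<^sub>R y\<close>.\<close>
  then have y: "y = (1 / (1 + a)) *\<^sub>R u + k *\<^sub>R m + k *\<^sub>R z"
    using a by (simp add: scaleR_add_right k_def)
  have "A *v (y - (1 / a) *\<^sub>R w) - H *v y = A *v z + (A *v m - H *v y)"
    by (simp add: z_def matrix_vector_mult_diff_distrib)
  moreover have "(norm (p + q))\<^sup>2 - (norm q)\<^sup>2 = p \<bullet> p + 2 * (p \<bullet> q)" for p q :: "real^'n"
    by (simp add: power2_norm_eq_inner inner_add_left inner_add_right inner_commute)
  ultimately have 1: "(norm (A *v (y - (1 / a) *\<^sub>R w) - H *v y))\<^sup>2 - (norm (A *v m - H *v y))\<^sup>2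
      = (A *v z) \<bullet> (A *v z) + 2 * ((A *v z) \<bullet> (A *v m - H *v y))"
    by (simp only:)
  have 2: "(A *v z) \<bullet> (A *v m - H *v y) = (A *v z) \<bullet> (A *v m) - (1 / (1 + a)) * ((A *v z) \<bullet> (H *v u))
      - k * ((A *v z) \<bullet> (H *v m)) - k * ((A *v z) \<bullet> (H *v z))"
    by (subst y) (simp add: inner_diff_right inner_add_right matrix_vector_right_distrib matrix_vector_mult_scaleR)
  show ?thesis
    unfolding 1 2
    by (simp add: ip inner_commute[of _ z] inner_diff_right matrix_vector_mul_assoc
        matrix_vector_mult_diff_distrib matrix_vector_mult_scaleR algebra_simps)
qed

section \<open>Integrability of the loss and mean of its correction\<close>

text \<open>Expanding around the mean leaves a constant, a linear form and a quadratic form in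
  \<open>Y s - m\<close>, each integrable.\<close>

lemma mvn_isotropic_norm_affine_integrable:
  fixes Y :: "'a \<Rightarrow> real^'n" and H :: "real^'n^'k"
  assumes P: "prob_space P" and Y: "mvn_distributed P Y m (mat v)" and v: "v > 0"
  shows "integrable P (\<lambda>s. (norm (c - H *v Y s))\<^sup>2)"
proof -
  interpret prob_space P by fact
  define d where "d = c - H *v m"
  have 1: "(norm (c - H *v x))\<^sup>2
      = (norm d)\<^sup>2 - 2 * ((transpose H *v d) \<bullet> (x - m)) + (x - m) \<bullet> ((transpose H ** H) *v (x - m))" for x
  proof -
    have "c - H *v x = d - H *v (x - m)"
      by (simp add: d_def matrix_vector_mult_diff_distrib)
    moreover have "(norm (d - h))\<^sup>2 = (norm d)\<^sup>2 - 2 * (d \<bullet> h) + h \<bullet> h" for h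
      by (simp add: power2_norm_eq_inner inner_diff_left inner_diff_right inner_commute)
    moreover have "d \<bullet> (H *v z) = (transpose H *v d) \<bullet> z" "(H *v z) \<bullet> (H *v z) = z \<bullet> ((transpose H ** H) *v z)" for z
      by (metis dot_lmul_matrix vector_transpose_matrix transpose_transpose matrix_vector_mul_assoc)+
    ultimately show ?thesis by simp
  qed
  show ?thesis
    unfolding 1
    using mvn_isotropic_linear_form[OF Y v] mvn_isotropic_quadratic_form[OF Y v]
    by (intro Bochner_Integration.integrable_add Bochner_Integration.integrable_diff
        integrable_mult_right integrable_const) (auto simp: has_bochner_integral_iff)
qed

text \<open>The set \<open>S\<close> stands for the event that a given model is selected, on which
  \<open>H\<close> is fixed. Its indicator is a function of \<open>y + w\<close>, so it multiplies
  centred terms in \<open>y - w / a\<close> without disturbing their zero mean; the trace terms are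
  what centres the two quadratic forms.\<close>

lemma (in prob_space) loss_correction_mean_zero:
  fixes y w :: "'a \<Rightarrow> real^'n" and A H :: "real^'n^'k"
  assumes a: "a > 0" and v: "v > 0"
    and y: "mvn_distributed M y m (mat v)" and w: "mvn_distributed M w 0 (mat (a * v))"
    and ind: "indep_var borel y borel w" and S: "S \<in> sets borel"
  shows "has_bochner_integral M (\<lambda>s. indicator S (y s + w s) *
    ((norm (A *v (y s - (1 / a) *\<^sub>R w s) - H *v y s))\<^sup>2 + 2 * trace (transpose A ** H) * v
      - trace (transpose A ** A) * (1 + 1 / a) * v - (norm (A *v m - H *v y s))\<^sup>2)) 0"
proof -
  define k where "k = a / (1 + a)"
  define t where "t = (1 + 1 / a) * v"
  have t: "t > 0" using a v by (simp add: t_def add_pos_pos)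
  have "1 + 1 / a = (1 + a) / a" using a by (simp add: field_simps)
  \<comment> \<open>Here \<open>t\<close> is the variance of a coordinate of \<open>V\<close>,
    \<open>k\<close> is the regression coefficient of \<open>y\<close> on \<open>V\<close>, and
    \<open>k * t\<close> is their covariance. This is why the trace with \<open>H\<close> enters
    with \<open>v\<close>, free of \<open>a\<close>.\<close>
  then have kt: "k * t = v" using a by (simp add: k_def t_def)
  define U where "U s = y s + w s" for s
  define V where "V s = y s - (1 / a) *\<^sub>R w s" for s
  have UV: "indep_var borel U borel V" and V: "mvn_distributed M V m (mat t)"
    using mvn_isotropic_decorrelate[OF a v y w ind] by (simp_all add: U_def[abs_def] V_def[abs_def] t_def)
  have [measurable]: "U \<in> borel_measurable M" "S \<in> sets borel"
    using UV S by (auto dest: indep_var_rv1)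
  have q: "has_bochner_integral M (\<lambda>s. (indicator S (U s) :: real) * ((V s - m) \<bullet> (B *v (V s - m)) - trace B * t)) 0" for B
  proof (rule indep_var_mult_mean_zero[OF UV])
    show "integrable M (\<lambda>s. indicator S (U s) :: real)"
      by (intro integrable_const_bound[where B = 1]) auto
    show "has_bochner_integral M (\<lambda>s. (V s - m) \<bullet> (B *v (V s - m)) - trace B * t) 0"
      using mvn_isotropic_quadratic_form[OF V t, of B] by (simp add: has_bochner_integral_iff prob_space)
    show "(\<lambda>x. (x - m) \<bullet> (B *v (x - m)) - trace B * t) \<in> borel_measurable borel"
      unfolding inner_matrix_vector_eq_sum by (intro borel_measurable_continuous_onI continuous_intros)
  qed simp
  \<comment> \<open>The coefficient of the linear form is affine in \<open>U\<close>, hence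
    unbounded, so its integrability has to come from that of the coordinates of
    \<open>U\<close>.\<close>
  have comp: "integrable M (\<lambda>s. U s $ i)" for i
  proof -
    have "integrable M (\<lambda>s. (y s - m) $ i + (w s - 0) $ i + m $ i)"
      using mvn_isotropic_mean[OF y v, of i] mvn_isotropic_mean[OF w, of i] a v
      by (intro Bochner_Integration.integrable_add) (auto simp: has_bochner_integral_iff)
    then show ?thesis by (simp add: U_def)
  qed
  have l: "has_bochner_integral M (\<lambda>s. indicator S (U s) * ((c + C *v U s) \<bullet> (V s - m))) 0" for c and C :: "real^'n^'n"
  proof -
    have "has_bochner_integral M (\<lambda>s. \<Sum>i\<in>UNIV. (indicator S (U s) * (c + C *v U s) $ i) * (V s - m) $ i) (\<Sum>i\<in>(UNIV :: 'n set). 0)"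
    proof (intro has_bochner_integral_sum indep_var_mult_mean_zero[OF UV] mvn_isotropic_mean[OF V t])
      fix i
      have "integrable M (\<lambda>s. c $ i + (\<Sum>j\<in>UNIV. C $ i $ j * U s $ j))"
        by (intro Bochner_Integration.integrable_add Bochner_Integration.integrable_sum integrable_mult_right comp) simp
      then have int: "integrable M (\<lambda>s. (c + C *v U s) $ i)" by (simp add: matrix_vector_mult_def)
      show "integrable M (\<lambda>s. indicator S (U s) * (c + C *v U s) $ i)"
      proof (rule Bochner_Integration.integrable_bound[OF int])
        show "(\<lambda>s. indicator S (U s) * (c + C *v U s) $ i) \<in> borel_measurable M"
          using borel_measurable_integrable[OF int] by (intro borel_measurable_times) measurable
      qed (auto simp: indicator_def)
      show "(\<lambda>u. indicator S u * (c + C *v u) $ i) \<in> borel_measurable borel"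
        by (intro borel_measurable_times borel_measurable_indicator
            borel_measurable_continuous_onI[of "\<lambda>u. (c + C *v u) $ i"] continuous_intros) simp
      show "(\<lambda>u. (u - m) $ i) \<in> borel_measurable borel"
        by (intro borel_measurable_continuous_onI continuous_intros)
    qed
    then show ?thesis by (simp add: inner_vec_def sum_distrib_left mult.assoc)
  qed
  define c where "c = transpose A *v (A *v m - k *\<^sub>R (H *v m))"
  \<comment> \<open>The sign is absorbed into \<open>C\<close> so that the linear term has the form
    \<open>c + C *v U s\<close> treated in \<open>l\<close>.\<close>
  define C where "C = (- (1 / (1 + a))) *\<^sub>R (transpose A ** H)"
  \<comment> \<open>Bookkeeping over the reals: \<open>N1\<close>, \<open>N2\<close> are the two
    squared norms, \<open>Q1\<close>, \<open>Q2\<close> the quadratic forms, \<open>T1\<close>,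
    \<open>T2\<close> their traces and \<open>L\<close> the linear form. Centring each
    \<open>Q\<close> at its trace times \<open>t\<close> and using \<open>k * t = v\<close> produces
    the terms of the estimator.\<close>
  have collect: "i * (Q1 - T1 * t) - 2 * k * (i * (Q2 - T2 * t)) + 2 * (i * L)
      = i * (N1 + 2 * T2 * v - T1 * (1 + 1 / a) * v - N2)"
    if "N1 - N2 = Q1 - 2 * k * Q2 + 2 * L" for i Q1 Q2 T1 T2 L N1 N2 :: real
  proof -
    have "T1 * (1 + 1 / a) * v = T1 * t" by (simp add: t_def)
    moreover have "N1 = N2 + Q1 - 2 * k * Q2 + 2 * L" using that by simp
    ultimately show ?thesis by (simp only: kt[symmetric]) (simp add: algebra_simps)
  qed
  have "has_bochner_integral M
     (\<lambda>s. indicator S (U s) * ((V s - m) \<bullet> ((transpose A ** A) *v (V s - m)) - trace (transpose A ** A) * t)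
       - 2 * k * (indicator S (U s) * ((V s - m) \<bullet> ((transpose A ** H) *v (V s - m)) - trace (transpose A ** H) * t))
       + 2 * (indicator S (U s) * ((c + C *v U s) \<bullet> (V s - m)))) (0 - 2 * k * 0 + 2 * 0)"
    by (intro has_bochner_integral_add has_bochner_integral_diff has_bochner_integral_mult_right q l)
  moreover have "indicator S (U s) * ((V s - m) \<bullet> ((transpose A ** A) *v (V s - m)) - trace (transpose A ** A) * t)
       - 2 * k * (indicator S (U s) * ((V s - m) \<bullet> ((transpose A ** H) *v (V s - m)) - trace (transpose A ** H) * t))
       + 2 * (indicator S (U s) * ((c + C *v U s) \<bullet> (V s - m)))
     = indicator S (y s + w s) *
    ((norm (A *v (y s - (1 / a) *\<^sub>R w s) - H *v y s))\<^sup>2 + 2 * trace (transpose A ** H) * v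
      - trace (transpose A ** A) * (1 + 1 / a) * v - (norm (A *v m - H *v y s))\<^sup>2)" for s
    unfolding U_def
  proof (rule collect)
    have C: "(c + C *v (y s + w s)) = c - (1 / (1 + a)) *\<^sub>R ((transpose A ** H) *v (y s + w s))"
      unfolding C_def by (subst scaleR_matrix_vector_assoc[symmetric]) simp
    show "(norm (A *v (y s - (1 / a) *\<^sub>R w s) - H *v y s))\<^sup>2 - (norm (A *v m - H *v y s))\<^sup>2
      = (V s - m) \<bullet> ((transpose A ** A) *v (V s - m)) - 2 * k * ((V s - m) \<bullet> ((transpose A ** H) *v (V s - m)))
        + 2 * ((c + C *v (y s + w s)) \<bullet> (V s - m))"
      unfolding C unfolding c_def V_def k_def by (rule loss_difference[OF a])
  qed
  ultimately show ?thesis by simp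
qed

section \<open>Summation over the possible selections\<close>

theorem lemma4p3:
  fixes X Xnew :: "real^'p^'n"
    and \<mu> :: "real^'p^'n \<Rightarrow> real^'n"
    and \<beta>0 :: "real^'p"
    and \<sigma> \<alpha> :: real
    and P :: "'a measure"
    and y w :: "'a \<Rightarrow> real^'n"
    and Mhat :: "real^'n \<Rightarrow> 'p set"
  assumes "rank X = CARD('p)"
    and "\<mu> X = X *v \<beta>0" and "\<mu> Xnew = Xnew *v \<beta>0"
    and "\<sigma> > 0" and "\<alpha> > 0"
    and "prob_space P"
    and "mvn_distributed P y (\<mu> X) (mat (\<sigma>\<^sup>2))"
    and "mvn_distributed P w 0 (mat (\<alpha> * \<sigma>\<^sup>2))"
    and "prob_space.indep_var P borel y borel w"
    and "Mhat \<in> measurable borel (count_space UNIV)"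
  shows "integrable P (pred_loss X Xnew (\<mu> Xnew) Mhat y w) \<and>
    unbiased P (err_out_hat X Xnew \<sigma> \<alpha> Mhat y w)
      (err_out P X Xnew (\<mu> Xnew) \<sigma> Mhat y w)"
proof -
  interpret prob_space P by fact
  have v: "\<sigma>\<^sup>2 > 0" using \<open>\<sigma> > 0\<close> by simp
  define H0 where "H0 = full_hat_matrix X Xnew"
  define H where "H = hat_matrix X Xnew"
  define S where "S M = Mhat -` {M}" for M
  have S: "S M \<in> sets borel" for M
    using measurable_sets[OF assms(10), of "{M}"] by (simp add: S_def)
  have [measurable]: "y \<in> borel_measurable P" "w \<in> borel_measurable P" "S M \<in> sets borel" for M
    using indep_var_rv1[OF assms(9)] indep_var_rv2[OF assms(9)] S by auto
  have \<mu>new: "\<mu> Xnew = H0 *v \<mu> X"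
    by (simp add: H0_def assms(2,3) full_hat_matrix_fitted[OF assms(1)])
  \<comment> \<open>There are finitely many models, so a quantity with a random hat matrix is a
    finite sum of fixed-matrix quantities, each restricted to its selection event.\<close>
  have pick: "(\<Sum>M\<in>UNIV. indicator (S M) u * f M) = f (Mhat u)" for u and f :: "'p set \<Rightarrow> real"
    by (simp add: S_def indicator_def sum.delta if_distrib[of "\<lambda>c. c * _"] cong: if_cong)
  define p where "p M s = (norm (\<mu> Xnew - H M *v y s))\<^sup>2" for M s
  \<comment> \<open>For a fixed model, \<open>q M\<close> is the estimator minus the true loss
    \<open>p M\<close> minus the constant noise term.\<close>
  define q where "q M s = (norm (H0 *v (y s - (1 / \<alpha>) *\<^sub>R w s) - H M *v y s))\<^sup>2
      + 2 * trace (transpose H0 ** H M) * \<sigma>\<^sup>2 - trace (transpose H0 ** H0) * (1 + 1 / \<alpha>) * \<sigma>\<^sup>2 - p M s" for M s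
  have loss: "pred_loss X Xnew (\<mu> Xnew) Mhat y w s = (\<Sum>M\<in>UNIV. indicator (S M) (y s + w s) * p M s)" for s
    by (simp add: pick p_def pred_loss_def Let_def cols_beta_bar H_def)
  \<comment> \<open>The estimator is the loss plus the noise term plus a sum whose expectation
    vanishes model by model; unbiasedness is read off from this.\<close>
  have est: "err_out_hat X Xnew \<sigma> \<alpha> Mhat y w s = pred_loss X Xnew (\<mu> Xnew) Mhat y w s
      + real CARD('n) * \<sigma>\<^sup>2 + (\<Sum>M\<in>UNIV. indicator (S M) (y s + w s) * q M s)" for s
    unfolding loss pick by (simp add: q_def err_out_hat_def Let_def H_def H0_def)
  have int: "integrable P (pred_loss X Xnew (\<mu> Xnew) Mhat y w)"
    unfolding loss[abs_def]
  proof (intro Bochner_Integration.integrable_sum)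
    fix M
    have p: "integrable P (p M)"
      unfolding p_def using assms(7) by (intro mvn_isotropic_norm_affine_integrable[OF _ _ v] assms)
    then have [measurable]: "p M \<in> borel_measurable P" by auto
    from p show "integrable P (\<lambda>s. indicator (S M) (y s + w s) * p M s)"
      by (rule Bochner_Integration.integrable_bound) (auto simp: indicator_def)
  qed
  have "has_bochner_integral P (\<lambda>s. indicator (S M) (y s + w s) * q M s) 0" for M
    unfolding q_def p_def \<mu>new
    by (rule loss_correction_mean_zero[OF assms(5) v assms(7,8,9) S])
  then have "has_bochner_integral P (\<lambda>s. \<Sum>M\<in>UNIV. indicator (S M) (y s + w s) * q M s) (\<Sum>M\<in>(UNIV :: 'p set set). 0)"
    by (intro has_bochner_integral_sum)
  then have "has_bochner_integral P (err_out_hat X Xnew \<sigma> \<alpha> Mhat y w) (err_out P X Xnew (\<mu> Xnew) \<sigma> Mhat y w)"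
    using int by (simp add: est[abs_def] err_out_def has_bochner_integral_iff prob_space)
  with int show ?thesis by (simp add: unbiased_def has_bochner_integral_iff)
qed

end
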